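(* Let $\Sigma_3=\{a<b<c\}$ and let $w\in \Sigma_3^*$ be $M$-ambiguous. Then $d_H([w])\in \{2,4,7,8\}$.
   Context: For an ordered alphabet $\Sigma=\{a_1<a_2<\dots<a_s\}$, the Parikh matrix mapping $\Psi_\Sigma$ is the monoid morphism from $\Sigma^*$ to the multiplicative monoid of $(s+1)\times(s+1)$ upper triangular matrices with nonnegative integer entries and unit diagonal, where $\Psi_\Sigma(a_q)$ is the identity matrix with the additional entry $1$ in position $(q,q+1)$. Equivalently (known fact), for $1\le i\le j\le s$ the $(i,j+1)$ entry of $\Psi_\Sigma(w)$ is $|w|_{a_ia_{i+1}\cdots a_j}$, where $|w|_v$ is the number of distinct occurrences of $v$ as a (scattered) subsequence of $w$. Words $w,w'\in\Sigma^*$ are $M$-equivalent if $\Psi_\Sigma(w)=\Psi_\Sigma(w')$; $[w]$ denotes the $M$-equivalence class of $w$. A word is $M$-ambiguous if it is $M$-equivalent to a word distinct from it. For words $w,w'$ of equal length, the Hamming distance $d_H(w,w')$ is the number of positions in which their corresponding letters differ. For $M$-ambiguous $w$, the minimal Hamming distance of $[w]$ is $d_H([w])=\min\{d_H(w',w'') : w',w''\in[w],\ w'\ne w''\}$ (all words in $[w]$ have the same length). *)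

theory Defs
  imports "Jordan_Normal_Form.Matrix"
begin

text \<open>
  An ordered alphabet is a finite subset of a linearly ordered type, with the induced order.
  Matrix indices start at 0, so the letter \<open>a\<^sub>q\<close> (\<open>q = 1, \<dots>, s\<close>) has index \<open>q - 1\<close>, and the extra
  entry of its matrix is at position \<open>(q - 1, q)\<close>.
\<close>

definition letter_index :: "'a::linorder set \<Rightarrow> 'a \<Rightarrow> nat" where
  "letter_index \<Sigma> x = card {y \<in> \<Sigma>. y < x}"

definition letter_matrix :: "'a::linorder set \<Rightarrow> 'a \<Rightarrow> nat mat" where
  "letter_matrix \<Sigma> x = mat (card \<Sigma> + 1) (card \<Sigma> + 1)
     (\<lambda>(i, j). if i = j \<or> (i = letter_index \<Sigma> x \<and> j = letter_index \<Sigma> x + 1) then 1 else 0)"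

fun parikh_matrix :: "'a::linorder set \<Rightarrow> 'a list \<Rightarrow> nat mat" where
  "parikh_matrix \<Sigma> [] = 1\<^sub>m (card \<Sigma> + 1)"
| "parikh_matrix \<Sigma> (x # w) = letter_matrix \<Sigma> x * parikh_matrix \<Sigma> w"

lemma letter_matrix_carrier:
  "letter_matrix \<Sigma> x \<in> carrier_mat (card \<Sigma> + 1) (card \<Sigma> + 1)"
  by (simp add: letter_matrix_def)

lemma parikh_matrix_carrier:
  "parikh_matrix \<Sigma> w \<in> carrier_mat (card \<Sigma> + 1) (card \<Sigma> + 1)"
proof (induction w)
  case Nil
  show ?case by simp
next
  case (Cons x w)
  then show ?case
    unfolding parikh_matrix.simps by (rule mult_carrier_mat[OF letter_matrix_carrier])
qed

lemma parikh_matrix_singleton: "parikh_matrix \<Sigma> [x] = letter_matrix \<Sigma> x"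
  unfolding parikh_matrix.simps by (rule right_mult_one_mat[OF letter_matrix_carrier])

lemma parikh_matrix_append:
  "parikh_matrix \<Sigma> (u @ v) = parikh_matrix \<Sigma> u * parikh_matrix \<Sigma> v"
proof (induction u)
  case Nil
  show ?case
    unfolding parikh_matrix.simps append_Nil
    by (rule left_mult_one_mat[OF parikh_matrix_carrier, symmetric])
next
  case (Cons x u)
  then show ?case
    using assoc_mult_mat[OF letter_matrix_carrier parikh_matrix_carrier parikh_matrix_carrier,
      of \<Sigma> x u v]
    by simp
qed

definition M_equivalent :: "'a::linorder set \<Rightarrow> 'a list \<Rightarrow> 'a list \<Rightarrow> bool" where
  "M_equivalent \<Sigma> w w' \<longleftrightarrow>
     w \<in> lists \<Sigma> \<and> w' \<in> lists \<Sigma> \<and> parikh_matrix \<Sigma> w = parikh_matrix \<Sigma> w'"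

definition M_class :: "'a::linorder set \<Rightarrow> 'a list \<Rightarrow> 'a list set" where
  "M_class \<Sigma> w = {w'. M_equivalent \<Sigma> w w'}"

definition M_ambiguous :: "'a::linorder set \<Rightarrow> 'a list \<Rightarrow> bool" where
  "M_ambiguous \<Sigma> w \<longleftrightarrow> (\<exists>w'. M_equivalent \<Sigma> w w' \<and> w' \<noteq> w)"

text \<open>Only meaningful for words of equal length.\<close>

definition hamming_dist :: "'a list \<Rightarrow> 'a list \<Rightarrow> nat" where
  "hamming_dist u v = card {i. i < length u \<and> u ! i \<noteq> v ! i}"

text \<open>
  The minimum over a set of natural numbers, written with \<open>LEAST\<close>, which needs no finiteness of
  the set. The value is unspecified unless the set \<open>C\<close> contains two distinct words.
\<close>

definition min_hamming_dist :: "'a list set \<Rightarrow> nat" where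
  "min_hamming_dist C =
     (LEAST d. \<exists>u v. u \<in> C \<and> v \<in> C \<and> u \<noteq> v \<and> d = hamming_dist u v)"

end

theory Submission
  imports Defs
begin

text \<open>
  Describe a word by the \<^emph>\<open>position\<close> of each letter a or c, the number of letters b before it. Up to
  fixed letter counts, the Parikh matrix records the sum of the positions of the a's, the sum of
  the positions of the c's, and the number of occurrences of abc, which is the sum of
  \<open>max 0 (h - g)\<close> over all positions g of an a and h of a c.

  Suppose that all distances in the class exceed 4. Then no word of the class has adjacent a and c,
  nor an ab and a ba (or bc and cb) that could be exchanged, so apart from its two ends each word
  alternates between single a's and c's separated by runs of b. On five consecutive such letters
  there are moves that preserve the matrix, and iterating them produces adjacent a and c unless the
  two outer runs of b have length 1. A similar move on seven letters limits the number of
  alternating blocks to seven. With at least two a's and two c's, the sums of the positions and the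
  count of abc now determine the word, except when there are four blocks: then the class is a
  one-parameter family in which four letters move by the same amount m in the directions
  \<open>+ - - +\<close>. Two of its members differ in 8 places, or in 7 if an old and a new letter position
  coincide.
\<close>

section \<open>Counts of scattered subwords over three letters\<close>

datatype letter = A | B | C

fun occ :: "'a list \<Rightarrow> 'a list \<Rightarrow> nat" where
  "occ w [] = 1"
| "occ [] (p # ps) = 0"
| "occ (z # w) (p # ps) = occ w (p # ps) + (if z = p then occ w ps else 0)"

lemma occ_Nil [simp]: "occ w [] = 1"
  by (cases w) auto

lemma occ_append1 [simp]: "occ (u @ v) [x] = occ u [x] + occ v [x]"
  by (induction u) auto

lemma occ_append2 [simp]:
  "occ (u @ v) [x, y] = occ u [x, y] + occ v [x, y] + occ u [x] * occ v [y]"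
  by (induction u) (auto simp: algebra_simps)

lemma occ_append3 [simp]:
  "occ (u @ v) [x, y, z] =
     occ u [x, y, z] + occ v [x, y, z] + occ u [x] * occ v [y, z] + occ u [x, y] * occ v [z]"
  by (induction u) (auto simp: algebra_simps)

lemma occ_replicate1 [simp]: "occ (replicate n x) [y] = (if x = y then n else 0)"
  by (induction n) auto

lemma occ_replicate2 [simp]: "y \<noteq> z \<Longrightarrow> occ (replicate n x) [y, z] = 0"
  by (induction n) auto

lemma occ_replicate3 [simp]: "x \<noteq> y \<Longrightarrow> y \<noteq> z \<Longrightarrow> occ (replicate n t) [x, y, z] = 0"
  by (induction n) auto

lemma occ_map: "inj f \<Longrightarrow> occ (map f w) (map f p) = occ w p"
  by (induction w p rule: occ.induct) (auto simp: inj_eq)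

lemma occ_eq_0_iff: "occ w [x] = 0 \<longleftrightarrow> x \<notin> set w"
  by (induction w) auto

lemma occ_ab_ba: "x \<noteq> y \<Longrightarrow> occ w [x, y] + occ w [y, x] = occ w [x] * occ w [y]"
  by (induction w) (auto simp: algebra_simps)

text \<open>Sum over the letters b. One with p letters a before it and p' after it, and r and r'
  letters c, contributes p r' + r p' + p' r' to either side. The identity makes the number of cba a
  function of \<open>pv\<close>.\<close>

lemma occ_abc_cba:
  fixes w :: "letter list"
  shows "occ w [A, B, C] + occ w [C] * occ w [B, A] = occ w [C, B, A] + occ w [A] * occ w [B, C]"
proof (induction w)
  case (Cons z w)
  show ?case
    using Cons occ_ab_ba[of A B w] occ_ab_ba[of C B w]
    by (cases z) (auto simp: algebra_simps)
qed simp

lemma length_occ: "length w = occ w [A] + occ w [B] + occ w [C]"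
proof (induction w)
  case (Cons z w)
  then show ?case by (cases z) auto
qed simp

text \<open>These are the six entries above the diagonal of the Parikh matrix, so equal values mean
  M-equivalence.\<close>

definition pv :: "letter list \<Rightarrow> nat \<times> nat \<times> nat \<times> nat \<times> nat \<times> nat" where
  "pv w = (occ w [A], occ w [B], occ w [C], occ w [A, B], occ w [B, C], occ w [A, B, C])"

lemma pv_append_cong: "pv u = pv u' \<Longrightarrow> pv v = pv v' \<Longrightarrow> pv (u @ v) = pv (u' @ v')"
  by (auto simp: pv_def)

lemma pv_context: "pv u = pv v \<Longrightarrow> pv (s @ u @ t) = pv (s @ v @ t)"
  by (intro pv_append_cong refl)

lemma pv_append_left_cancel: "pv (s @ u) = pv (s @ v) \<longleftrightarrow> pv u = pv v"
  by (auto simp: pv_def)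

lemma pv_append_right_cancel: "pv (u @ s) = pv (v @ s) \<longleftrightarrow> pv u = pv v"
  by (auto simp: pv_def)

lemma pv_Cons_cancel: "pv (z # u) = pv (z # v) \<longleftrightarrow> pv u = pv v"
  using pv_append_left_cancel[of "[z]"] by simp

lemma pv_ba: "pv u = pv v \<Longrightarrow> occ u [B, A] = occ v [B, A]"
  using occ_ab_ba[of A B u] occ_ab_ba[of A B v] by (auto simp: pv_def)

lemma pv_length: "pv u = pv v \<Longrightarrow> length u = length v"
  by (simp add: pv_def length_occ)

section \<open>The symmetry exchanging a and c\<close>

fun flip :: "letter \<Rightarrow> letter" where
  "flip A = C"
| "flip B = B"
| "flip C = A"

lemma flip_flip [simp]: "flip (flip l) = l"
  by (cases l) auto

lemma flip_comp_flip [simp]: "flip \<circ> flip = id"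
  by auto

lemma inj_flip: "inj flip"
  by (metis flip_flip injI)

abbreviation swap :: "letter list \<Rightarrow> letter list" where
  "swap \<equiv> map flip"

lemma occ_swap: "occ (swap w) p = occ w (swap p)"
  using occ_map[OF inj_flip, of w "swap p"] by simp

text \<open>After the exchange the entries ab, bc and abc count cb, ba and cba in the old word; by
  \<open>occ_ab_ba\<close> and \<open>occ_abc_cba\<close> these are determined by the old
  entries.\<close>

lemma pv_swap: "pv u = pv v \<Longrightarrow> pv (swap u) = pv (swap v)"
  using occ_abc_cba[of u] occ_abc_cba[of v] pv_ba[of u v]
    occ_ab_ba[of C B u] occ_ab_ba[of C B v]
  by (auto simp: pv_def occ_swap)

section \<open>Hamming distance, and why 0, 1 and 3 do not occur\<close>

lemma hamming_Nil [simp]: "hamming_dist [] v = 0"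
  by (simp add: hamming_dist_def)

lemma hamming_Cons [simp]:
  "hamming_dist (x # u) (y # v) = (if x = y then 0 else 1) + hamming_dist u v"
proof -
  have "{i. i < length (x # u) \<and> (x # u) ! i \<noteq> (y # v) ! i} =
      (if x = y then {} else {0}) \<union> Suc ` {i. i < length u \<and> u ! i \<noteq> v ! i}"
    by (auto simp: image_iff less_Suc_eq_0_disj)
  then show ?thesis
    by (simp add: hamming_dist_def card_insert_if card_image)
qed

lemma hamming_append [simp]:
  "length u = length v \<Longrightarrow> hamming_dist (u @ u') (v @ v') = hamming_dist u v + hamming_dist u' v'"
  by (induction u v rule: list_induct2) auto

lemma hamming_self [simp]: "hamming_dist u u = 0"
  by (induction u) auto

lemma hamming_sym: "length u = length v \<Longrightarrow> hamming_dist u v = hamming_dist v u"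
  by (induction u v rule: list_induct2) auto

lemma hamming_map: "inj f \<Longrightarrow> length u = length v \<Longrightarrow> hamming_dist (map f u) (map f v) = hamming_dist u v"
  by (rotate_tac, induction u v rule: list_induct2) (auto simp: inj_eq)

lemma hamming_eq_0: "length u = length v \<Longrightarrow> hamming_dist u v = 0 \<longleftrightarrow> u = v"
  by (induction u v rule: list_induct2) auto

lemma hamming_Suc:
  assumes "length u = length v" "hamming_dist u v = Suc n"
  obtains s x y u' v' where "u = s @ x # u'" "v = s @ y # v'" "x \<noteq> y"
    "length u' = length v'" "hamming_dist u' v' = n"
proof -
  have "\<exists>s x y u' v'. u = s @ x # u' \<and> v = s @ y # v' \<and> x \<noteq> y \<and>
      length u' = length v' \<and> hamming_dist u' v' = n"
    using assms
  proof (induction u v rule: list_induct2)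
    case (Cons x u y v)
    show ?case
    proof (cases "x = y")
      case True
      then obtain s x' y' u' v' where "u = s @ x' # u'" "v = s @ y' # v'" "x' \<noteq> y'"
        "length u' = length v'" "hamming_dist u' v' = n"
        using Cons by auto
      then show ?thesis
        using True by (intro exI[of _ "x # s"] exI) auto
    next
      case False
      then show ?thesis
        using Cons by (intro exI[of _ "[]"] exI) auto
    qed
  qed simp
  then show thesis
    using that by blast
qed

text \<open>A single changed letter alters a letter count. Three changes that keep the letter counts
  permute three distinct letters cyclically, and this alters one of the other counts.\<close>

lemma hamming_ne_0_1_3:
  assumes "pv u = pv v" "u \<noteq> v"
  shows "hamming_dist u v \<notin> {0, 1, 3}"
proof -
  have len: "length u = length v"
    using assms(1) by (rule pv_length)
  have "hamming_dist u v \<noteq> 0"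
    using hamming_eq_0[OF len] assms(2) by simp
  moreover have "hamming_dist u v \<noteq> 1"
  proof
    assume "hamming_dist u v = 1"
    then obtain s x y u' v' where 1: "u = s @ x # u'" "v = s @ y # v'" "x \<noteq> y"
      "length u' = length v'" "hamming_dist u' v' = 0"
      using hamming_Suc[OF len] by (metis One_nat_def)
    then show False
      using assms(1) by (cases x; cases y) (auto simp: hamming_eq_0 pv_def)
  qed
  moreover have "hamming_dist u v \<noteq> 3"
  proof
    assume "hamming_dist u v = 3"
    then obtain s x y u1 v1 where 1: "u = s @ x # u1" "v = s @ y # v1" "x \<noteq> y"
      "length u1 = length v1" "hamming_dist u1 v1 = 2"
      using hamming_Suc[OF len, of 2] by (metis eval_nat_numeral(3))
    obtain s1 x1 y1 u2 v2 where 2: "u1 = s1 @ x1 # u2" "v1 = s1 @ y1 # v2" "x1 \<noteq> y1"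
      "length u2 = length v2" "hamming_dist u2 v2 = 1"
      using hamming_Suc[OF 1(4), of 1] 1(5) by (metis Suc_1)
    obtain s2 x2 y2 u3 v3 where 3: "u2 = s2 @ x2 # u3" "v2 = s2 @ y2 # v3" "x2 \<noteq> y2"
      "length u3 = length v3" "hamming_dist u3 v3 = 0"
      using hamming_Suc[OF 2(4), of 0] 2(5) by (metis One_nat_def)
    have "u3 = v3"
      using 3 by (simp add: hamming_eq_0)
    then have "pv (s @ ([x] @ s1 @ [x1] @ s2 @ [x2]) @ u3) = pv (s @ ([y] @ s1 @ [y1] @ s2 @ [y2]) @ u3)"
      using assms(1) 1 2 3 by simp
    then have "pv ([x] @ s1 @ [x1] @ s2 @ [x2]) = pv ([y] @ s1 @ [y1] @ s2 @ [y2])"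
      by (simp only: pv_append_left_cancel pv_append_right_cancel)
    then have eq: "pv (x # s1 @ x1 # s2 @ [x2]) = pv (y # s1 @ y1 # s2 @ [y2])"
      by simp
    \<comment> \<open>If two of the three letters were equal, no rearrangement would differ in all
      three places. Six orders and two fixed-point-free permutations give twelve cases.\<close>
    have "(x, x1, x2, y, y1, y2) \<in> {(A, B, C, B, C, A), (A, C, B, C, B, A), (B, A, C, A, C, B),
        (B, C, A, C, A, B), (C, A, B, A, B, C), (C, B, A, B, A, C),
        (A, B, C, C, A, B), (A, C, B, B, A, C), (B, A, C, C, B, A),
        (B, C, A, A, B, C), (C, A, B, B, C, A), (C, B, A, A, C, B)}"
    proof -
      have cnt: "(if x = l then 1 else 0) + (if x1 = l then 1 else 0) + (if x2 = l then 1 else 0) =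
          (if y = l then 1 else 0) + (if y1 = l then 1 else 0) + (if y2 = l then 1 else (0::nat))" for l
      proof -
        have "occ (x # s1 @ x1 # s2 @ [x2]) [l] = occ (y # s1 @ y1 # s2 @ [y2]) [l]"
          using eq by (cases l) (simp_all only: pv_def prod.inject)
        then show ?thesis
          by (simp split del: if_split cong: if_cong add: ac_simps)
      qed
      show ?thesis
        using cnt[of A] cnt[of B] cnt[of C] 1(3) 2(3) 3(3)
        by (cases x; cases y; simp; cases x1; cases y1; simp; cases x2; cases y2; simp)
    qed
    then show False
      using eq by (auto simp: pv_def)
  qed
  ultimately show ?thesis by simp
qed

section \<open>Classes with all distances above 4\<close>

definition tight :: "letter list \<Rightarrow> bool" where
  "tight w \<longleftrightarrow> (\<forall>u v. pv u = pv w \<longrightarrow> pv v = pv w \<longrightarrow> u \<noteq> v \<longrightarrow> 4 < hamming_dist u v)"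

lemma tight_cong: "pv u = pv v \<Longrightarrow> tight u \<longleftrightarrow> tight v"
  by (simp add: tight_def)

text \<open>Replacing a factor by a word with the same \<open>pv\<close> keeps the \<open>pv\<close>
  of the whole, and the common context adds nothing to the distance. Hence local exchanges suffice
  to refute tightness.\<close>

lemma tight_factor:
  assumes "tight (s @ w @ t)"
  shows "tight w"
  unfolding tight_def
proof (intro allI impI)
  fix u v assume *: "pv u = pv w" "pv v = pv w" "u \<noteq> v"
  then have "4 < hamming_dist (s @ u @ t) (s @ v @ t)"
    using assms unfolding tight_def by (metis append_same_eq pv_context same_append_eq)
  moreover have "length u = length v"
    using * by (intro pv_length) simp
  ultimately show "4 < hamming_dist u v" by simp
qed

lemma tight_swap: "tight w \<Longrightarrow> tight (swap w)"
  unfolding tight_def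
proof (intro allI impI)
  fix u v
  assume t: "\<forall>u v. pv u = pv w \<longrightarrow> pv v = pv w \<longrightarrow> u \<noteq> v \<longrightarrow> 4 < hamming_dist u v"
    and *: "pv u = pv (swap w)" "pv v = pv (swap w)" "u \<noteq> v"
  have "pv (swap u) = pv w" "pv (swap v) = pv w"
    using *(1,2)[THEN pv_swap] by simp_all
  then have "4 < hamming_dist (swap u) (swap v)"
    using t *(3) by (simp add: inj_flip inj_map_eq_map)
  moreover have "length u = length v"
    using * by (intro pv_length) simp
  ultimately show "4 < hamming_dist u v"
    by (simp add: hamming_map inj_flip)
qed

lemma not_tightI:
  assumes "pv u = pv v" "u \<noteq> v" "hamming_dist u v \<le> 4"
  shows "\<not> tight (s @ u @ t)"
proof
  assume "tight (s @ u @ t)"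
  then have "tight u" by (rule tight_factor)
  then show False
    using assms unfolding tight_def by (metis not_less)
qed

text \<open>No recorded subword has a and c side by side, so exchanging two such neighbours keeps
  \<open>pv\<close>, at distance 2.\<close>

lemma not_tight_adjacent:
  assumes "l \<in> {A, C}"
  shows "\<not> tight (s @ l # flip l # t)"
  using assms not_tightI[of "[l, flip l]" "[flip l, l]" s t] by (auto simp: pv_def)

text \<open>Both letters \<open>l\<close> step outwards over one b, a change in four places. The sum
  of their positions is kept, and so is the number of abc because no \<open>flip l\<close> lies
  between them.\<close>

lemma not_tight_outward:
  assumes "l \<in> {A, C}" "flip l \<notin> set y"
  shows "\<not> tight (s @ B # l # y @ l # B # t)"
  using assms not_tightI[of "[B, l] @ y @ [l, B]" "[l, B] @ y @ [B, l]" s t]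
  by (auto simp: pv_def occ_eq_0_iff[THEN iffD2])

section \<open>The shape of tight words\<close>

fun alt :: "letter \<Rightarrow> nat list \<Rightarrow> letter list" where
  "alt l [] = [l]"
| "alt l (d # ds) = l # replicate d B @ alt (flip l) ds"

definition final :: "letter \<Rightarrow> nat list \<Rightarrow> letter" where
  "final l ds = (if even (length ds) then l else flip l)"

text \<open>In the core \<open>alt l ds\<close> the letters a and c alternate with gaps
  \<open>ds\<close>. Its first and last letter may have further copies, but only at the very ends of
  the word, set off by one run of b.\<close>

definition shape :: "letter \<Rightarrow> nat \<Rightarrow> nat \<Rightarrow> nat list \<Rightarrow> nat \<Rightarrow> nat \<Rightarrow> letter list" where
  "shape l i x ds j y =
     replicate i l @ replicate x B @ alt l ds @ replicate y B @ replicate j (final l ds)"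

lemma alt_hd: "\<exists>t. alt l ds = l # t"
  by (cases ds) auto

lemma no_rise:
  assumes "set w \<subseteq> {l, B}" "\<And>s t. w \<noteq> s @ l # B # t"
  shows "\<exists>y j. w = replicate y B @ replicate j l"
  using assms
proof (induction w)
  case (Cons z w)
  have "w \<noteq> s @ l # B # t" for s t
    using Cons.prems(2)[of "z # s" t] by auto
  then obtain y j where w: "w = replicate y B @ replicate j l"
    using Cons by auto
  show ?case
  proof (cases "z = B")
    case True
    then show ?thesis
      using w by (intro exI[of _ "Suc y"] exI[of _ j]) simp
  next
    case False
    then have "z = l" using Cons.prems(1) by simp
    moreover have "y = 0"
      using Cons.prems(2)[of "[]"] w \<open>z = l\<close> by (cases y) auto
    ultimately show ?thesis
      using w by (intro exI[of _ 0] exI[of _ "Suc j"]) simp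
  qed
qed simp

lemma first_occurrence:
  assumes "l \<in> set w" "set w \<subseteq> {l, B}"
  shows "\<exists>m w'. w = replicate m B @ l # w'"
  using assms
proof (induction w)
  case (Cons z w)
  show ?case
  proof (cases "z = l")
    case True
    then show ?thesis by (intro exI[of _ 0]) simp
  next
    case False
    then obtain m w' where "w = replicate m B @ l # w'" "z = B"
      using Cons by auto
    then show ?thesis
      by (intro exI[of _ "Suc m"]) simp
  qed
qed simp

lemma tight_tl: "tight (z # w) \<Longrightarrow> tight w"
  using tight_factor[of "[z]" w "[]"] by simp

text \<open>The word is built from the right. A front letter that breaks the shape creates an
  adjacent a and c, or two equal letters that can move outwards. The base case is a front letter
  that is the only one of its kind.\<close>

lemma shape_exists:
  assumes "tight w" "A \<in> set w" "C \<in> set w"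
  shows "\<exists>l i x ds j y. l \<in> {A, C} \<and> ds \<noteq> [] \<and> (\<forall>d\<in>set ds. 1 \<le> d) \<and>
           w = shape l i x ds j y"
  using assms
proof (induction w)
  case (Cons z w)
  have tw: "tight w"
    using Cons.prems(1) by (rule tight_tl)
  show ?case
  proof (cases "A \<in> set w \<and> C \<in> set w")
    case True
    then obtain l i x ds j y where *: "l \<in> {A, C}" "ds \<noteq> []" "\<forall>d\<in>set ds. 1 \<le> d"
      "w = shape l i x ds j y"
      using Cons.IH tw by blast
    obtain d es where ds: "ds = d # es" "1 \<le> d"
      using *(2,3) by (cases ds) auto
    consider "z = B" | "z = l" | "z = flip l"
      using *(1) by (cases z) auto
    then show ?thesis
    proof cases
      case 1
      \<comment> \<open>Otherwise the new b with the first \<open>l\<close>, and the first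
        \<open>l\<close> of the core with the b behind it, can be exchanged outwards.\<close>
      have "i = 0"
      proof (rule ccontr)
        assume "i \<noteq> 0"
        then obtain k where k: "i = Suc k" by (cases i) auto
        obtain e where e: "d = Suc e" using ds(2) by (cases d) auto
        have "z # w = [] @ B # l # (replicate k l @ replicate x B) @ l # B #
            (replicate e B @ alt (flip l) es @ replicate y B @ replicate j (final l ds))"
          using 1 *(4) ds(1) k e by (simp add: shape_def)
        moreover have "flip l \<notin> set (replicate k l @ replicate x B)"
          using *(1) by auto
        ultimately show False
          using not_tight_outward[OF *(1)] Cons.prems(1) by metis
      qed
      then have "z # w = shape l 0 (Suc x) ds j y"
        using 1 *(4) by (simp add: shape_def)
      then show ?thesis
        using * by (intro exI[of _ l] exI[of _ 0] exI[of _ "Suc x"] exI[of _ ds] exI[of _ j] exI[of _ y]) simp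
    next
      case 2
      have "z # w = shape l (Suc i) x ds j y"
        using 2 *(4) by (simp add: shape_def)
      then show ?thesis
        using * by (intro exI[of _ l] exI[of _ "Suc i"] exI[of _ x] exI[of _ ds] exI[of _ j] exI[of _ y]) simp
    next
      case 3
      \<comment> \<open>An \<open>l\<close> directly behind \<open>z\<close> is excluded, so the run
        \<open>x\<close> becomes the first gap of the longer core.\<close>
      have "i = 0 \<and> 1 \<le> x"
      proof (rule ccontr)
        assume "\<not> (i = 0 \<and> 1 \<le> x)"
        then obtain t where "w = l # t"
          using *(4) ds(1) by (cases i; cases x) (auto simp: shape_def)
        then show False
          using not_tight_adjacent[of z "[]" t] Cons.prems(1) 3 *(1) by auto
      qed
      moreover from this have "z # w = shape z 0 0 (x # ds) j y"
        using 3 *(4) by (simp add: shape_def final_def)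
      ultimately show ?thesis
        using * 3
        by (intro exI[of _ z] exI[of _ 0] exI[of _ "x # ds"] exI[of _ j] exI[of _ y]) auto
    qed
  next
    case False
    define l where "l = flip z"
    have l: "l \<in> {A, C}" "z = flip l" "z \<notin> set w" "l \<in> set w"
      using False Cons.prems(2,3) by (cases z; auto simp: l_def)+
    have sw: "set w \<subseteq> {l, B}"
    proof
      fix k assume "k \<in> set w"
      moreover have "k \<in> {l, B, flip l}"
        using l(1) by (cases k) auto
      ultimately show "k \<in> {l, B}"
        using l by auto
    qed
    obtain m w' where m: "w = replicate m B @ l # w'"
      using first_occurrence[OF l(4) sw] by blast
    have "m \<noteq> 0"
    proof
      assume "m = 0"
      then show False
        using not_tight_adjacent[of z "[]" w'] Cons.prems(1) m l by auto
    qed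
    then obtain k where k: "m = Suc k" by (cases m) auto
    have "w' \<noteq> s @ l # B # t" for s t
    proof
      assume "w' = s @ l # B # t"
      then have "w = replicate k B @ B # l # s @ l # B # t"
        using m k by (simp add: replicate_app_Cons_same)
      moreover have "flip l \<notin> set s"
        using l m \<open>w' = _\<close> by auto
      ultimately show False
        using tw not_tight_outward[OF l(1)] by metis
    qed
    then obtain y j where w': "w' = replicate y B @ replicate j l"
      using no_rise[of w' l] sw m by auto
    have "z # w = shape z 0 0 [m] j y"
      using l m w' by (auto simp: shape_def final_def)
    then show ?thesis
      using l \<open>m \<noteq> 0\<close>
      by (intro exI[of _ z] exI[of _ 0] exI[of _ "[m]"] exI[of _ j] exI[of _ y]) auto
  qed
qed simp

section \<open>Moves on five and seven alternating letters\<close>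

lemma not_tight_pv:
  assumes "pv u = pv v" "\<not> tight (s @ v @ t)"
  shows "\<not> tight (s @ u @ t)"
  using assms tight_cong pv_context by blast

text \<open>
  The moves \<open>left\<close> and \<open>right\<close> shrink the outer gaps \<open>(d1, d4)\<close> by \<open>(2, 1)\<close> and \<open>(1, 2)\<close>. From
  every pair other than \<open>(1, 1)\<close> some sequence of them makes one gap vanish.
\<close>

lemma window_A:
  assumes "1 \<le> d1" "1 \<le> d2" "1 \<le> d3" "1 \<le> d4" "tight (s @ alt A [d1, d2, d3, d4] @ t)"
  shows "d1 = 1 \<and> d4 = 1"
  using assms
proof (induction "d1 + d4" arbitrary: d1 d2 d3 d4 s t rule: less_induct)
  case less
  \<comment> \<open>\<open>left\<close> moves the first four letters over one b each in the
    directions \<open>+ - - +\<close>, and \<open>right\<close> the last four in the directions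
    \<open>- + + -\<close>; the remaining letter keeps its position.\<close>
  have left: "pv (alt A [d1, d2, d3, d4]) = pv (B # alt A [d1 - 2, d2, d3 + 2, d4 - 1])" if ge: "2 \<le> d1"
  proof -
    obtain e1 e4 where "d1 = e1 + 2" "d4 = e4 + 1"
      using ge less.prems(4) by (intro that[of "d1 - 2" "d4 - 1"]) auto
    then show ?thesis by (simp add: pv_def del: replicate_Suc)
  qed
  have right: "pv (alt A [d1, d2, d3, d4]) = pv (alt A [d1 - 1, d2 + 2, d3, d4 - 2] @ [B])" if ge: "2 \<le> d4"
  proof -
    obtain e1 e4 where "d1 = e1 + 1" "d4 = e4 + 2"
      using ge less.prems(1) by (intro that[of "d1 - 1" "d4 - 2"]) auto
    then show ?thesis by (simp add: pv_def del: replicate_Suc)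
  qed
  have gap1: "\<not> tight (s' @ alt A (0 # ds) @ t')" for s' ds t'
    using alt_hd[of C ds] not_tight_adjacent[of A s'] by auto
  have gap4: "\<not> tight (s' @ alt A [e1, e2, e3, 0] @ t')" for s' e1 e2 e3 t'
    using not_tight_adjacent[of C "s' @ A # replicate e1 B @ C # replicate e2 B @ A # replicate e3 B" t']
    by simp
  have left_tight: "tight ((s @ [B]) @ alt A [d1 - 2, d2, d3 + 2, d4 - 1] @ t)" if "2 \<le> d1"
    using less.prems(5) not_tight_pv[OF left[OF that], of s t] by auto
  have right_tight: "tight (s @ alt A [d1 - 1, d2 + 2, d3, d4 - 2] @ (B # t))" if "2 \<le> d4"
    using less.prems(5) not_tight_pv[OF right[OF that], of s t] by auto
  show ?case
  proof (rule ccontr)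
    assume ne: "\<not> (d1 = 1 \<and> d4 = 1)"
    \<comment> \<open>In the first four cases one move makes an outer gap 0. In the last,
      \<open>left\<close> leads to smaller positive outer gaps that are not both 1, against the
      induction hypothesis.\<close>
    then consider "d1 = 1" "2 \<le> d4" | "d4 = 1" "2 \<le> d1" | "d1 = 2" | "d4 = 2" | "3 \<le> d1" "3 \<le> d4"
      using less.prems(1,4) by linarith
    then show False
    proof cases
      case 1
      then show ?thesis using right_tight gap1[of s "[d2 + 2, d3, d4 - 2]" "B # t"] by simp
    next
      case 2
      then show ?thesis using left_tight gap4[of "s @ [B]" "d1 - 2" d2 "d3 + 2" t] by simp
    next
      case 3
      then show ?thesis using left_tight gap1[of "s @ [B]" "[d2, d3 + 2, d4 - 1]" t] by simp
    next
      case 4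
      then show ?thesis using right_tight gap4[of s "d1 - 1" "d2 + 2" d3 "B # t"] by simp
    next
      case 5
      have "d1 - 2 = 1 \<and> d4 - 1 = 1"
        by (rule less.hyps[OF _ _ _ _ _ left_tight]) (use 5 less.prems in auto)
      then show ?thesis using 5 by auto
    qed
  qed
qed

lemma swap_alt: "swap (alt l ds) = alt (flip l) ds"
  by (induction l ds rule: alt.induct) (auto simp: map_replicate)

lemma window:
  assumes "1 \<le> d1" "1 \<le> d2" "1 \<le> d3" "1 \<le> d4" "l \<in> {A, C}"
    and "tight (s @ alt l [d1, d2, d3, d4] @ t)"
  shows "d1 = 1 \<and> d4 = 1"
proof (cases "l = A")
  case True
  then show ?thesis using window_A assms by blast
next
  case False
  then have "swap (s @ alt l [d1, d2, d3, d4] @ t) = swap s @ alt A [d1, d2, d3, d4] @ swap t"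
    using assms(5) by (simp add: swap_alt)
  then have "tight (swap s @ alt A [d1, d2, d3, d4] @ swap t)"
    using tight_swap[OF assms(6)] by simp
  then show ?thesis using window_A assms by blast
qed

lemma window_prefix:
  assumes "1 \<le> d1" "1 \<le> d2" "1 \<le> d3" "1 \<le> d4" "l \<in> {A, C}"
    and "tight (s @ alt l (d1 # d2 # d3 # d4 # ds) @ t)"
  shows "d1 = 1 \<and> d4 = 1"
proof -
  obtain u where "alt l ds = l # u"
    using alt_hd by blast
  then have "s @ alt l (d1 # d2 # d3 # d4 # ds) @ t = s @ alt l [d1, d2, d3, d4] @ (u @ t)"
    by simp
  then show ?thesis
    using window assms by metis
qed

text \<open>For \<open>l = A\<close> the witness keeps the letters c and moves the four letters a by
  \<open>+ - - +\<close>, which puts an a next to a c. The b behind the word makes room for the last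
  a.\<close>

lemma not_tight_seven_right:
  assumes "l \<in> {A, C}"
  shows "\<not> tight (s @ alt l [1, 1, 1, 1, 1, 1] @ B # t)"
proof -
  have "\<not> tight (s @ (alt A [1, 1, 1, 1, 1, 1] @ [B]) @ t)" for s t
  proof (rule not_tight_pv)
    show "pv (alt A [1, 1, 1, 1, 1, 1] @ [B]) =
        pv ([B] @ A # flip A # [A, B, B, C, A, B, B, C, B, B, A])"
      by (simp add: pv_def)
    show "\<not> tight (s @ ([B] @ A # flip A # [A, B, B, C, A, B, B, C, B, B, A]) @ t)"
      using not_tight_adjacent[of A "s @ [B]"] by simp
  qed
  from this[of s t] this[of "swap s" "swap t"] show ?thesis
    using assms tight_swap[of "s @ alt l [1, 1, 1, 1, 1, 1] @ B # t"] by auto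
qed

text \<open>Here the four letters a move by \<open>- + + -\<close>, the first one over the b in
  front.\<close>

lemma not_tight_seven_left:
  assumes "l \<in> {A, C}"
  shows "\<not> tight (s @ B # alt l [1, 1, 1, 1, 1, 1] @ t)"
proof -
  have "\<not> tight (s @ (B # alt A [1, 1, 1, 1, 1, 1]) @ t)" for s t
  proof (rule not_tight_pv)
    show "pv (B # alt A [1, 1, 1, 1, 1, 1]) =
        pv ([A, B, B, C, B, B, A, C, B, B] @ A # flip A # [A, B])"
      by (simp add: pv_def)
    show "\<not> tight (s @ ([A, B, B, C, B, B, A, C, B, B] @ A # flip A # [A, B]) @ t)"
      using not_tight_adjacent[of A "s @ [A, B, B, C, B, B, A, C, B, B]"] by simp
  qed
  from this[of s t] this[of "swap s" "swap t"] show ?thesis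
    using assms tight_swap[of "s @ B # alt l [1, 1, 1, 1, 1, 1] @ t"] by auto
qed

section \<open>Tight words with at most one c are determined by \<open>pv\<close>\<close>

lemma pv_set: "pv u = pv v \<Longrightarrow> set u = set v"
proof -
  assume eq: "pv u = pv v"
  have "occ u [x] = occ v [x]" for x
    using eq by (cases x) (simp_all add: pv_def)
  then show ?thesis
    by (metis occ_eq_0_iff subsetI subset_antisym)
qed

text \<open>By tightness only the first a of \<open>B # v\<close> can have letters b behind it, so
  the number of ab is less than the number of b. In \<open>A # u\<close> the leading a already
  precedes every b.\<close>

lemma binary_clash:
  assumes "tight (B # v)" "C \<notin> set v" "pv (A # u) = pv (B # v)"
  shows False
proof -
  have "A \<in> set v"
    using pv_set[OF assms(3)] by auto
  moreover have sub: "set v \<subseteq> {A, B}"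
  proof
    fix k assume "k \<in> set v"
    then show "k \<in> {A, B}"
      using assms(2) letter.exhaust[of k "k \<in> {A, B}"] by auto
  qed
  ultimately obtain m w where v: "v = replicate m B @ A # w"
    using first_occurrence by blast
  then have "set w \<subseteq> {A, B}"
    using sub by simp
  have "w \<noteq> s @ A # B # t" for s t
  proof
    assume "w = s @ A # B # t"
    moreover from this have "flip A \<notin> set s"
      using \<open>set w \<subseteq> {A, B}\<close> by auto
    ultimately show False
      using not_tight_outward[of A s "replicate m B" t] assms(1) v
      by (simp add: replicate_app_Cons_same)
  qed
  then obtain y j where "w = replicate y B @ replicate j A"
    using no_rise \<open>set w \<subseteq> {A, B}\<close> by blast
  then show False
    using assms(3) v by (auto simp: pv_def)
qed

lemma tight_unique_without_C:
  assumes "tight u" "pv u = pv v" "C \<notin> set u"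
  shows "u = v"
  using assms
proof (induction u arbitrary: v)
  case Nil
  then show ?case using pv_length[of "[]" v] by simp
next
  case (Cons z u)
  have "length v = Suc (length u)"
    using pv_length[OF Cons.prems(2)] by simp
  then obtain z' v' where v: "v = z' # v'"
    by (cases v) auto
  have "C \<notin> set v"
    using Cons.prems(3) pv_set[OF Cons.prems(2)] by metis
  have "tight v"
    using Cons.prems(1,2) tight_cong by blast
  show ?case
  proof (cases "z = z'")
    case True
    then show ?thesis
      using Cons v tight_tl pv_Cons_cancel by auto
  next
    case False
    then have "(z = A \<and> z' = B) \<or> (z = B \<and> z' = A)"
      using Cons.prems(3) \<open>C \<notin> set v\<close> v by (cases z; cases z') auto
    then show ?thesis
      using binary_clash[of v' u] binary_clash[of u v'] Cons.prems \<open>tight v\<close> \<open>C \<notin> set v\<close> v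
      by auto
  qed
qed

text \<open>Such words occur to the left of the only c of a tight word and, reversed, to its
  right.\<close>

definition half :: "letter list \<Rightarrow> bool" where
  "half w \<longleftrightarrow> (\<exists>h. w = replicate h B) \<or>
     (\<exists>i x d. w = replicate i A @ replicate x B @ A # replicate d B \<and> 1 \<le> d)"

text \<open>This is division by \<open>h\<close> with remainders from 1 to \<open>h\<close> instead
  of 0 to \<open>h - 1\<close>.\<close>

lemma quotient_unique:
  fixes i h :: nat
  assumes "i * h + d = i' * h + d'" "0 < d" "d \<le> h" "0 < d'" "d' \<le> h"
  shows "i = i' \<and> d = d'"
proof -
  have "\<not> k < k'" if "k * h + e = k' * h + e'" "e \<le> h" "0 < e'" for k k' e e'
  proof
    assume "k < k'"
    then have "(k + 1) * h \<le> k' * h"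
      by (intro mult_le_mono1) simp
    then show False
      using that by simp
  qed
  from this[of i d i' d'] this[of i' d' i d] assms show ?thesis
    by (auto simp: not_less)
qed

text \<open>In the second form the number of ab is \<open>i * (x + d) + d\<close>, where
  \<open>x + d\<close> is the number of b; so \<open>i\<close> and \<open>d\<close> are quotient and
  remainder. The first form is recognised by having no ab.\<close>

lemma half_unique:
  assumes "half u" "half v" "occ u [B] = occ v [B]" "occ u [A, B] = occ v [A, B]"
  shows "u = v"
proof -
  have *: "occ (replicate i A @ replicate x B @ A # replicate d B) [A, B] = i * (x + d) + d"
    "occ (replicate i A @ replicate x B @ A # replicate d B) [B] = x + d" for i x d
    by (auto simp: algebra_simps)
  show ?thesis
  proof (cases "occ u [A, B] = 0")
    case True
    then show ?thesis
      using assms unfolding half_def by (auto simp: *)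
  next
    case False
    then obtain i x d i' x' d' where
      u: "u = replicate i A @ replicate x B @ A # replicate d B" "1 \<le> d" and
      v: "v = replicate i' A @ replicate x' B @ A # replicate d' B" "1 \<le> d'"
      using assms(1,2,4) unfolding half_def by auto
    have "x + d = x' + d'" "i * (x + d) + d = i' * (x' + d') + d'"
      using assms(3,4) u(1) v(1) * by simp_all
    then show ?thesis
      using quotient_unique[of i "x + d" d i' d'] u v by auto
  qed
qed

lemma occ_rev1: "occ (rev w) [x] = occ w [x]"
  by (induction w) auto

lemma occ_rev2: "occ (rev w) [x, y] = occ w [y, x]"
  by (induction w) (auto simp: occ_rev1)

lemma occ_alt_pos: "1 \<le> occ (alt l ds) [l]"
  by (cases ds) auto

text \<open>With only one c, the letters of the core read ac, aca or ca, and no c is left for the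
  ends.\<close>

lemma single_C_halves:
  assumes "tight w" "A \<in> set w" "occ w [C] = 1"
  obtains s t where "w = s @ C # t" "half s" "half (rev t)"
proof -
  have "C \<in> set w"
    using assms(3) occ_eq_0_iff[of w C] by auto
  then obtain l i x ds j y where *: "l \<in> {A, C}" "ds \<noteq> []" "\<forall>d\<in>set ds. 1 \<le> d"
      "w = shape l i x ds j y"
    using shape_exists[OF assms(1,2) \<open>C \<in> set w\<close>] by blast
  obtain d1 es where d1: "ds = d1 # es"
    using *(2) by (cases ds) auto
  have one: "half (replicate h B)" for h
    by (auto simp: half_def)
  have two: "half (replicate i A @ replicate x B @ A # replicate d B)" if "1 \<le> d" for i x d
    using that by (auto simp: half_def)
  show thesis
  proof (cases "l = A")
    case True
    show thesis
    proof (cases es)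
      case Nil
      then have "w = (replicate i A @ replicate x B @ A # replicate d1 B) @ C # replicate y B"
        using * d1 assms(3) True by (simp add: shape_def final_def)
      then show thesis
        by (rule that) (use one two *(3) d1 in auto)
    next
      case (Cons d2 fs)
      have "fs = []"
        using assms(3) *(4) d1 Cons True occ_alt_pos[of C "tl fs"]
        by (cases fs) (auto simp: shape_def)
      then have "w = (replicate i A @ replicate x B @ A # replicate d1 B) @
          C # (replicate d2 B @ A # replicate y B @ replicate j A)"
        using * d1 Cons assms(3) True by (simp add: shape_def final_def)
      then show thesis
        by (rule that) (use two *(3) d1 Cons in auto)
    qed
  next
    case False
    then have l: "l = C" using *(1) by simp
    have "es = []"
      using assms(3) *(4) d1 l occ_alt_pos[of C "tl es"]
      by (cases es) (auto simp: shape_def)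
    then have "w = replicate x B @ C # (replicate d1 B @ A # replicate y B @ replicate j A)"
      using * d1 assms(3) l by (simp add: shape_def final_def)
    then show thesis
      by (rule that) (use one two *(3) d1 in auto)
  qed
qed

text \<open>The entries bc and abc count b and ab to the left of the only c, which fixes the left
  half. After cancelling it, the right half is fixed by its ba count, the ab count of its
  reversal.\<close>

lemma tight_unique_single_C:
  assumes "tight u" "pv u = pv v" "A \<in> set u" "occ u [C] = 1"
  shows "u = v"
proof -
  have v: "tight v" "A \<in> set v" "occ v [C] = 1"
    using assms tight_cong[OF assms(2)] pv_set[OF assms(2)] by (auto simp: pv_def)
  obtain s t where st: "u = s @ C # t" "half s" "half (rev t)"
    using single_C_halves assms by blast
  obtain s' t' where st': "v = s' @ C # t'" "half s'" "half (rev t')"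
    using single_C_halves v by blast
  have no_C: "C \<notin> set w" if "half w" for w
    using that by (auto simp: half_def)
  have occ_0: "occ w [C] = 0 \<and> occ w [B, C] = 0 \<and> occ w [A, B, C] = 0" if "C \<notin> set w" for w
    using that by (induction w) auto
  have "occ s [B] = occ s' [B]" "occ s [A, B] = occ s' [A, B]"
    using assms(2) st st' no_C[of s] no_C[of s'] no_C[of "rev t"] no_C[of "rev t'"]
    by (auto simp: pv_def occ_0)
  then have "s = s'"
    using half_unique st(2) st'(2) by blast
  then have "pv t = pv t'"
    using assms(2) st st' by (simp add: pv_append_left_cancel pv_Cons_cancel)
  then have "occ (rev t) [B] = occ (rev t') [B]" "occ (rev t) [A, B] = occ (rev t') [A, B]"
    using pv_ba[of t t'] by (simp_all add: occ_rev1 occ_rev2 pv_def)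
  then have "rev t = rev t'"
    using half_unique st(3) st'(3) by blast
  then show ?thesis
    using st st' \<open>s = s'\<close> by simp
qed

section \<open>Forms of tight words with at least two a and two c\<close>

text \<open>The number in a name such as \<open>form4\<close> counts the alternating blocks of letters a and c.\<close>

definition form2 :: "letter list \<Rightarrow> bool" where
  "form2 w \<longleftrightarrow> (\<exists>i x d j y. w = shape A i x [d] j y \<and> 1 \<le> d)"

definition form4 :: "letter list \<Rightarrow> bool" where
  "form4 w \<longleftrightarrow> (\<exists>i x d1 d2 d3 j y. w = shape A i x [d1, d2, d3] j y \<and> 1 \<le> d1 \<and> 1 \<le> d2 \<and> 1 \<le> d3)"

definition form5 :: "letter list \<Rightarrow> bool" where
  "form5 w \<longleftrightarrow> (\<exists>i x d2 d3 j y. w = shape A i x [1, d2, d3, 1] j y)"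

definition form6 :: "letter list \<Rightarrow> bool" where
  "form6 w \<longleftrightarrow> (\<exists>i x g j y. w = shape A i x [1, 1, g, 1, 1] j y)"

definition form7 :: "letter list \<Rightarrow> bool" where
  "form7 w \<longleftrightarrow> (\<exists>i j. w = shape A i 0 [1, 1, 1, 1, 1, 1] j 0)"

lemma swap_shape: "swap (shape l i x ds j y) = shape (flip l) i x ds j y"
  by (simp add: shape_def final_def swap_alt)

text \<open>Every window of five letters has outer gaps 1. Windows at the first, second and third
  letter leave two free gaps in a core of five letters, one in a core of six and none in a core of
  seven. A b on either side of seven such letters is impossible, which also excludes an eighth
  letter.\<close>

lemma shape_A_forms:
  assumes "tight w" "w = shape A i x ds j y" "ds \<noteq> []" "\<forall>d\<in>set ds. 1 \<le> d"
    and "2 \<le> occ w [C]"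
  shows "form2 w \<or> form4 w \<or> form5 w \<or> form6 w \<or> form7 w"
proof -
  have tight: "tight ((replicate i A @ replicate x B) @ alt A ds @ replicate y B @ replicate j (final A ds))"
    using assms(1,2) by (simp add: shape_def)
  obtain d1 ds1 where 1: "ds = d1 # ds1" "1 \<le> d1"
    using assms(3,4) by (cases ds) auto
  show ?thesis
  proof (cases ds1)
    case Nil
    then show ?thesis
      unfolding form2_def using 1 assms(2) by blast
  next
    case (Cons d2 ds2)
    note 2 = this
    \<comment> \<open>A core aca would contain only one c, and the letters at the end of the word
      would be a.\<close>
    have "ds2 \<noteq> []"
      using 1 2 assms(2,5) by (auto simp: shape_def final_def)
    then obtain d3 ds3 where 3: "ds2 = d3 # ds3"
      by (cases ds2) auto
    show ?thesis
    proof (cases ds3)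
      case Nil
      then have "w = shape A i x [d1, d2, d3] j y \<and> 1 \<le> d1 \<and> 1 \<le> d2 \<and> 1 \<le> d3"
        using 1 2 3 assms(2,4) by simp
      then show ?thesis
        unfolding form4_def by blast
    next
      case (Cons d4 ds4)
      note 4 = this
      have pos: "1 \<le> d1" "1 \<le> d2" "1 \<le> d3" "1 \<le> d4" "\<forall>d\<in>set ds4. 1 \<le> d"
        using 1 2 3 4 assms(4) by auto
      have 14: "d1 = 1 \<and> d4 = 1"
        using tight window_prefix[OF pos(1-4)] 1 2 3 4 by blast
      show ?thesis
      proof (cases ds4)
        case Nil
        then have "w = shape A i x [1, d2, d3, 1] j y"
          using 1 2 3 4 14 assms(2) by simp
        then show ?thesis
          unfolding form5_def by blast
      next
        case (Cons d5 ds5)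
        note 5 = this
        have "1 \<le> d5"
          using pos(5) 5 by simp
        define s where "s = (replicate i A @ replicate x B) @ A # replicate d1 B"
        have tight2: "tight (s @ alt C (d2 # d3 # d4 # d5 # ds5) @ replicate y B @ replicate j (final A ds))"
          using tight 1 2 3 4 5 unfolding s_def by simp
        have 25: "d2 = 1 \<and> d5 = 1"
          using window_prefix[OF pos(2-4) \<open>1 \<le> d5\<close> _ tight2] by simp
        show ?thesis
        proof (cases ds5)
          case Nil
          then have "w = shape A i x [1, 1, d3, 1, 1] j y"
            using 1 2 3 4 5 14 25 assms(2) by simp
          then show ?thesis
            unfolding form6_def by blast
        next
          case (Cons d6 ds6)
          note 6 = this
          have "1 \<le> d6"
            using pos(5) 5 6 by simp
          define s' where "s' = s @ C # replicate d2 B"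
          have "tight (s' @ alt A (d3 # d4 # d5 # d6 # ds6) @ replicate y B @ replicate j (final A ds))"
            using tight2 6 unfolding s'_def by simp
          then have 36: "d3 = 1 \<and> d6 = 1"
            using window_prefix[OF pos(3,4) \<open>1 \<le> d5\<close> \<open>1 \<le> d6\<close>] by blast
          have "ds6 = []"
          proof (rule ccontr)
            assume "ds6 \<noteq> []"
            then obtain e es where "ds6 = Suc e # es"
              using pos(5) 5 6 by (cases ds6; cases "hd ds6") auto
            then have "tight ((replicate i A @ replicate x B) @ alt A [1, 1, 1, 1, 1, 1] @
                B # (replicate e B @ alt C es @ replicate y B @ replicate j (final A ds)))"
              using tight 1 2 3 4 5 6 14 25 36 by simp
            then show False
              using not_tight_seven_right[of A "replicate i A @ replicate x B"] by blast
          qed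
          then have w: "w = shape A i x [1, 1, 1, 1, 1, 1] j y"
            using assms(2) 1 2 3 4 5 6 14 25 36 by simp
          have "x = 0"
          proof (rule ccontr)
            assume "x \<noteq> 0"
            then obtain e where "x = Suc e" by (cases x) auto
            then have "w = (replicate i A @ replicate e B) @ B # alt A [1, 1, 1, 1, 1, 1] @
                (replicate y B @ replicate j A)"
              using w by (simp add: shape_def final_def replicate_app_Cons_same)
            then show False
              using assms(1) not_tight_seven_left[of A "replicate i A @ replicate e B"] by blast
          qed
          moreover have "y = 0"
          proof (rule ccontr)
            assume "y \<noteq> 0"
            then obtain e where "y = Suc e" by (cases y) auto
            then have "w = (replicate i A @ replicate x B) @ alt A [1, 1, 1, 1, 1, 1] @
                B # (replicate e B @ replicate j A)"
              using w by (simp add: shape_def final_def)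
            then show False
              using assms(1) not_tight_seven_right[of A "replicate i A @ replicate x B"] by blast
          qed
          ultimately show ?thesis
            unfolding form7_def using w by blast
        qed
      qed
    qed
  qed
qed

lemma tight_forms:
  assumes "tight w" "2 \<le> occ w [A]" "2 \<le> occ w [C]"
  shows "(form2 w \<or> form4 w \<or> form5 w \<or> form6 w \<or> form7 w) \<or>
    (form2 (swap w) \<or> form4 (swap w) \<or> form5 (swap w) \<or> form6 (swap w) \<or> form7 (swap w))"
proof -
  have "A \<in> set w" "C \<in> set w"
    using assms(2,3) occ_eq_0_iff[of w] by force+
  then obtain l i x ds j y where *: "l \<in> {A, C}" "ds \<noteq> []" "\<forall>d\<in>set ds. 1 \<le> d"
      "w = shape l i x ds j y"
    using shape_exists[OF assms(1)] by blast
  show ?thesis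
  proof (cases "l = A")
    case True
    then show ?thesis
      using shape_A_forms[OF assms(1) _ *(2,3) assms(3)] *(4) by blast
  next
    case False
    then have "swap w = shape A i x ds j y"
      using *(1,4) by (auto simp: swap_shape)
    moreover have "2 \<le> occ (swap w) [C]"
      using assms(2) by (simp add: occ_swap)
    ultimately show ?thesis
      using shape_A_forms[OF tight_swap[OF assms(1)] _ *(2,3)] by blast
  qed
qed

section \<open>Bounds on the moment of each form\<close>

text \<open>
  The sum of the positions of the c's minus that of the a's. Its sign and size, together with the
  number of a's and c's, separate the forms from each other.
\<close>

definition moment :: "letter list \<Rightarrow> int" where
  "moment w = int (occ w [B, C]) - int (occ w [B, A])"

lemma moment_swap: "moment (swap w) = - moment w"
  by (simp add: moment_def occ_swap)

lemma moment_cong: "pv u = pv v \<Longrightarrow> moment u = moment v"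
  using pv_ba[of u v] by (simp add: moment_def pv_def)

text \<open>In \<open>form2\<close>, \<open>form4\<close> and \<open>form6\<close> the a's at the
  left end have position 0 and each c at the right end contributes the number of b. In the core each
  a pairs with the next c and contributes their gap. The sum of these gaps is positive and, for four
  or six blocks, less than the number of b.\<close>

lemma form2_moment:
  assumes "form2 w"
  shows "(int (occ w [C]) - 1) * int (occ w [B]) < moment w" "1 \<le> occ w [C]"
  using assms
  by (auto simp: form2_def shape_def final_def moment_def algebra_simps intro!: add_pos_nonneg)

lemma form4_moment:
  assumes "form4 w"
  shows "(int (occ w [C]) - 2) * int (occ w [B]) < moment w"
    "moment w < (int (occ w [C]) - 1) * int (occ w [B])" "2 \<le> occ w [C]"
  using assms
  by (auto simp: form4_def shape_def final_def moment_def algebra_simps intro!: add_pos_nonneg)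

lemma form6_moment:
  assumes "form6 w"
  shows "(int (occ w [C]) - 3) * int (occ w [B]) < moment w"
    "moment w < (int (occ w [C]) - 2) * int (occ w [B])" "3 \<le> occ w [C]" "3 \<le> occ w [A]"
  using assms
  by (auto simp: form6_def shape_def final_def moment_def algebra_simps intro!: add_pos_nonneg)

text \<open>In \<open>form5\<close> and \<open>form7\<close> each c of the core pairs with the next
  a, which counts negatively. These gaps and the position of the first a of the core add up to less
  than the number of b; every a at the right end contributes the full number.\<close>

lemma form5_moment:
  assumes "form5 w"
  shows "moment w < 0" "- moment w < (int (occ w [A]) - 2) * int (occ w [B])"
    "occ w [C] = 2" "3 \<le> occ w [A]"
  using assms
  by (auto simp: form5_def shape_def final_def moment_def algebra_simps intro!: add_pos_nonneg)

lemma form7_moment: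
  assumes "form7 w"
  shows "moment w < 0" "- moment w < (int (occ w [A]) - 3) * int (occ w [B])"
    "occ w [C] = 3" "4 \<le> occ w [A]"
  using assms
  by (auto simp: form7_def shape_def final_def moment_def algebra_simps intro!: add_pos_nonneg)

section \<open>Uniqueness within a form\<close>

lemma pv_occ:
  assumes "pv u = pv v"
  shows "occ u [A] = occ v [A]" "occ u [B] = occ v [B]" "occ u [C] = occ v [C]"
    "occ u [B, A] = occ v [B, A]" "occ u [B, C] = occ v [B, C]" "occ u [A, B, C] = occ v [A, B, C]"
  using assms pv_ba[OF assms] by (simp_all add: pv_def)

text \<open>The letter counts give \<open>i\<close> and \<open>j\<close>. Then the products with
  \<open>j\<close> agree and the remaining equations are linear, as they are in
  \<open>form6_unique\<close>.\<close>

lemma form2_unique: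
  assumes "form2 u" "form2 v" "pv u = pv v"
  shows "u = v"
proof -
  obtain i x d j y i' x' d' j' y' where
    u: "u = shape A i x [d] j y" and v: "v = shape A i' x' [d'] j' y'"
    using assms(1,2) unfolding form2_def by blast
  have cnt: "occ (shape A i x [d] j y) [A] = i + 1" "occ (shape A i x [d] j y) [C] = j + 1"
    "occ (shape A i x [d] j y) [B] = x + d + y" "occ (shape A i x [d] j y) [B, A] = x"
    "occ (shape A i x [d] j y) [B, C] = (x + d) + (x + d + y) * j" for i x d j y
    by (auto simp: shape_def final_def algebra_simps)
  note eq = pv_occ[OF assms(3), unfolded u v cnt]
  have "i = i'" "j = j'"
    using eq(1,3) by simp_all
  moreover have "(x + d + y) * j = (x' + d' + y') * j'"
    using eq(2) \<open>j = j'\<close> by simp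
  then have "x = x' \<and> d = d' \<and> y = y'"
    using eq(2,4,5) by linarith
  ultimately show ?thesis
    using u v by simp
qed

text \<open>Both ends consist of a's, so the letter counts give only \<open>i + j\<close>.
  Subtracting the bc count from the ba count leaves \<open>j\<close> times the number of b plus the
  remainder \<open>x + 1 + d2\<close>, which recovers \<open>j\<close>.\<close>

lemma form5_unique:
  assumes "form5 u" "form5 v" "pv u = pv v"
  shows "u = v"
proof -
  obtain i x d2 d3 j y i' x' d2' d3' j' y' where
    u: "u = shape A i x [1, d2, d3, 1] j y" and v: "v = shape A i' x' [1, d2', d3', 1] j' y'"
    using assms(1,2) unfolding form5_def by blast
  have cnt: "occ (shape A i x [1, d2, d3, 1] j y) [A] = i + j + 3"
    "occ (shape A i x [1, d2, d3, 1] j y) [B] = x + d2 + d3 + y + 2"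
    "occ (shape A i x [1, d2, d3, 1] j y) [B, A] =
        j * (x + d2 + d3 + y + 2) + (x + 1 + d2) + (2 * x + d2 + d3 + 2)"
    "occ (shape A i x [1, d2, d3, 1] j y) [B, C] = 2 * x + d2 + d3 + 2"
    "occ (shape A i x [1, d2, d3, 1] j y) [A, B, C] = i * (2 * x + d2 + d3 + 2) + d2 + 2 * d3 + 2"
    for i x d2 d3 j y
    by (auto simp: shape_def final_def algebra_simps)
  note eq = pv_occ[OF assms(3), unfolded u v cnt]
  have "j * (x + d2 + d3 + y + 2) + (x + 1 + d2) = j' * (x + d2 + d3 + y + 2) + (x' + 1 + d2')"
    using eq(2,4,5) by simp
  then have j: "j = j' \<and> x + 1 + d2 = x' + 1 + d2'"
    by (rule quotient_unique) (use eq(2) in linarith)+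
  then have i: "i = i'"
    using eq(1) by simp
  have "i * (2 * x + d2 + d3 + 2) = i' * (2 * x' + d2' + d3' + 2)"
    using i eq(5) by simp
  then have "x = x' \<and> d2 = d2' \<and> d3 = d3' \<and> y = y'"
    using eq(2,5,6) j by linarith
  then show ?thesis
    using u v i j by simp
qed

lemma form6_unique:
  assumes "form6 u" "form6 v" "pv u = pv v"
  shows "u = v"
proof -
  obtain i x g j y i' x' g' j' y' where
    u: "u = shape A i x [1, 1, g, 1, 1] j y" and v: "v = shape A i' x' [1, 1, g', 1, 1] j' y'"
    using assms(1,2) unfolding form6_def by blast
  have cnt: "occ (shape A i x [1, 1, g, 1, 1] j y) [A] = i + 3"
    "occ (shape A i x [1, 1, g, 1, 1] j y) [C] = j + 3"
    "occ (shape A i x [1, 1, g, 1, 1] j y) [B] = x + g + y + 4"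
    "occ (shape A i x [1, 1, g, 1, 1] j y) [B, A] = 3 * x + g + 5"
    "occ (shape A i x [1, 1, g, 1, 1] j y) [B, C] = (3 * x + 2 * g + 7) + (x + g + y + 4) * j"
    for i x g j y
    by (auto simp: shape_def final_def algebra_simps)
  note eq = pv_occ[OF assms(3), unfolded u v cnt]
  have ij: "i = i'" "j = j'"
    using eq(1,3) by simp_all
  have "(x + g + y + 4) * j = (x' + g' + y' + 4) * j'"
    using eq(2) ij by simp
  then have "x = x' \<and> g = g' \<and> y = y'"
    using eq(2,4,5) by linarith
  then show ?thesis
    using u v ij by simp
qed

lemma form7_unique:
  assumes "form7 u" "form7 v" "pv u = pv v"
  shows "u = v"
proof -
  obtain i j i' j' where
    u: "u = shape A i 0 [1, 1, 1, 1, 1, 1] j 0" and v: "v = shape A i' 0 [1, 1, 1, 1, 1, 1] j' 0"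
    using assms(1,2) unfolding form7_def by blast
  then show ?thesis
    using assms(3) pv_ba[OF assms(3)] by (auto simp: pv_def shape_def final_def)
qed

section \<open>Distances within the family with four blocks\<close>

lemma hamming_rotate:
  assumes "1 \<le> m" "x \<noteq> y"
  shows "hamming_dist (x # replicate m y) (replicate m y @ [x]) = 2"
proof -
  obtain k where "m = Suc k" using assms(1) by (cases m) auto
  then have *: "x # replicate m y = [x] @ replicate k y @ [y]"
    "replicate m y @ [x] = [y] @ replicate k y @ [x]"
    by (simp_all add: replicate_append_same)
  show ?thesis
    unfolding * using assms(2) by simp
qed

text \<open>The letters c and a move from places \<open>m\<close> and \<open>m + d + 1\<close> to 0
  and \<open>d + 1\<close>. These four places are distinct unless \<open>m = d + 1\<close>, when the
  new a falls on the old c and only three places differ.\<close>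

lemma hamming_shift:
  assumes "1 \<le> m" "1 \<le> d"
  shows "hamming_dist (replicate m B @ C # replicate d B @ [A]) (C # replicate d B @ A # replicate m B) \<in> {3, 4}"
proof -
  obtain k where k: "m = Suc k" using assms(1) by (cases m) auto
  consider "m = Suc d" | r where "d = m + r" | r where "m = Suc (Suc (d + r))"
    by (metis add_Suc_shift less_iff_Suc_add linorder_neqE_nat le_iff_add not_less_eq_eq)
  then show ?thesis
  proof cases
    case 1
    then have "replicate m B @ C # replicate d B @ [A] =
        [B] @ replicate d B @ [C] @ replicate d B @ [A]"
      "C # replicate d B @ A # replicate m B = [C] @ replicate d B @ [A] @ replicate d B @ [B]"
      by (simp_all add: replicate_append_same)
    then show ?thesis
      by (simp only: hamming_append length_append length_replicate) simp
  next
    case 2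
    have d_eq: "d = r + Suc k" "d = k + Suc r"
      using 2 k by simp_all
    have d: "replicate d B = replicate r B @ [B] @ replicate k B"
      unfolding d_eq(1) by (simp only: replicate_add replicate_Suc append.simps)
    have d': "replicate d B = replicate k B @ [B] @ replicate r B"
      unfolding d_eq(2) by (simp only: replicate_add replicate_Suc append.simps)
    have "replicate m B @ C # replicate d B @ [A] =
        [B] @ replicate k B @ [C] @ replicate r B @ [B] @ replicate k B @ [A]"
      unfolding d using k by simp
    moreover have "C # replicate d B @ A # replicate m B =
        [C] @ replicate k B @ [B] @ replicate r B @ [A] @ replicate k B @ [B]"
      unfolding d' using k by (simp add: replicate_append_same)
    ultimately show ?thesis
      by (simp only: hamming_append length_append length_replicate) simp
  next
    case 3
    have m_eq: "m = Suc (d + Suc r)" "m = r + Suc (d + Suc 0)"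
      using 3 by simp_all
    have m: "replicate m B = [B] @ replicate d B @ [B] @ replicate r B"
      unfolding m_eq(1) by (simp only: replicate_add replicate_Suc append.simps)
    have m': "replicate m B = replicate r B @ [B] @ replicate d B @ [B]"
      unfolding m_eq(2) by (simp only: replicate_add replicate_Suc append.simps replicate_0)
    have "replicate m B @ C # replicate d B @ [A] =
        [B] @ replicate d B @ [B] @ replicate r B @ [C] @ replicate d B @ [A]"
      unfolding m by simp
    moreover have "C # replicate d B @ A # replicate m B =
        [C] @ replicate d B @ [A] @ replicate r B @ [B] @ replicate d B @ [B]"
      unfolding m' by simp
    ultimately show ?thesis
      by (simp only: hamming_append length_append length_replicate) simp
  qed
qed

lemma hamming_form4:
  assumes "1 \<le> m" "1 \<le> d2"
  shows "hamming_dist (shape A i x [2 * m + d1, d2, d3] j (m + y))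
           (shape A i (x + m) [d1, d2, d3 + 2 * m] j y) \<in> {7, 8}"
proof -
  define s where "s = replicate i A @ replicate x B"
  define t where "t = replicate y B @ replicate j C"
  \<comment> \<open>Each gap of size at least \<open>2 * m\<close> is split so that the two letters
    bounding it move over separate runs of \<open>m\<close> letters b. Hence the three changed
    factors do not overlap.\<close>
  have e: "2 * m + d1 = m + (d1 + m)" "d3 + 2 * m = m + (d3 + m)"
    by simp_all
  have u: "shape A i x [2 * m + d1, d2, d3] j (m + y) =
      s @ (A # replicate m B) @ replicate d1 B @ (replicate m B @ C # replicate d2 B @ [A]) @
        replicate d3 B @ (C # replicate m B) @ t"
    unfolding e(1) by (simp add: shape_def final_def s_def t_def replicate_add)
  have v: "shape A i (x + m) [d1, d2, d3 + 2 * m] j y =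
      s @ (replicate m B @ [A]) @ replicate d1 B @ (C # replicate d2 B @ A # replicate m B) @
        replicate d3 B @ (replicate m B @ [C]) @ t"
    unfolding e(2) by (simp add: shape_def final_def s_def t_def replicate_add)
  have "hamming_dist (A # replicate m B) (replicate m B @ [A]) = 2"
    "hamming_dist (C # replicate m B) (replicate m B @ [C]) = 2"
    by (rule hamming_rotate[OF assms(1)], simp)+
  moreover have "hamming_dist (s @ p @ e @ q @ f @ r @ t) (s @ p' @ e @ q' @ f @ r' @ t) =
      hamming_dist p p' + hamming_dist q q' + hamming_dist r r'"
    if "length p = length p'" "length q = length q'" "length r = length r'" for p p' q q' r r' e f :: "letter list"
    using that by simp
  ultimately show ?thesis
    unfolding u v using hamming_shift[OF assms] by (simp del: hamming_Cons append_Cons append.simps append_assoc)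
qed

text \<open>Once the letter counts give \<open>i\<close> and \<open>j\<close>, the other counts are
  four linear equations for \<open>(x, d1, d2, d3, y)\<close>. Their solutions form a line in the
  direction \<open>(1, -2, 0, 2, -1)\<close>.\<close>

lemma form4_hamming:
  assumes "form4 u" "form4 v" "pv u = pv v" "u \<noteq> v"
  shows "hamming_dist u v \<in> {7, 8}"
proof -
  obtain i x d1 d2 d3 j y i' x' d1' d2' d3' j' y' where
    u: "u = shape A i x [d1, d2, d3] j y" "1 \<le> d2" and
    v: "v = shape A i' x' [d1', d2', d3'] j' y'" "1 \<le> d2'"
    using assms(1,2) unfolding form4_def by blast
  have cnt: "occ (shape A i x [d1, d2, d3] j y) [A] = i + 2"
    "occ (shape A i x [d1, d2, d3] j y) [C] = j + 2"
    "occ (shape A i x [d1, d2, d3] j y) [B] = x + d1 + d2 + d3 + y"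
    "occ (shape A i x [d1, d2, d3] j y) [B, A] = 2 * x + d1 + d2"
    "occ (shape A i x [d1, d2, d3] j y) [B, C] =
        (2 * x + 2 * d1 + d2 + d3) + (x + d1 + d2 + d3 + y) * j"
    "occ (shape A i x [d1, d2, d3] j y) [A, B, C] = i * (2 * x + 2 * d1 + d2 + d3) +
        (i * j) * (x + d1 + d2 + d3 + y) + (2 * d1 + d2 + 2 * d3) + j * (d1 + d2 + 2 * d3 + 2 * y)"
    for i x d1 d2 d3 j y
    by (auto simp: shape_def final_def algebra_simps)
  note eq = pv_occ[OF assms(3), unfolded u(1) v(1) cnt]
  have ij: "i = i'" "j = j'"
    using eq(1,3) by simp_all
  have "(x + d1 + d2 + d3 + y) * j = (x' + d1' + d2' + d3' + y') * j'"
    using eq(2) ij by simp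
  then have eq5: "2 * x + 2 * d1 + d2 + d3 = 2 * x' + 2 * d1' + d2' + d3'"
    using eq(5) by linarith
  have *: "d1 + d2 + 2 * d3 + 2 * y = d1' + d2' + 2 * d3' + 2 * y'"
    using eq(2,4) by linarith
  \<comment> \<open>The products with \<open>i\<close> and \<open>j\<close> agree on both sides and
    drop out of the abc count, which leaves the fourth linear equation.\<close>
  have "i * (2 * x + 2 * d1 + d2 + d3) = i' * (2 * x' + 2 * d1' + d2' + d3')"
    "(i * j) * (x + d1 + d2 + d3 + y) = (i' * j') * (x' + d1' + d2' + d3' + y')"
    "j * (d1 + d2 + 2 * d3 + 2 * y) = j' * (d1' + d2' + 2 * d3' + 2 * y')"
    using eq(2) eq5 * ij by simp_all
  then have eq6: "2 * d1 + d2 + 2 * d3 = 2 * d1' + d2' + 2 * d3'"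
    using eq(6) by linarith
  show ?thesis
  proof (cases x x' rule: linorder_cases)
    case less
    define m where "m = x' - x"
    have "d1 = 2 * m + d1'" "d2' = d2" "d3' = d3 + 2 * m" "y = m + y'" "x' = x + m" "1 \<le> m"
      using eq(2,4) eq5 eq6 less unfolding m_def by linarith+
    then show ?thesis
      using hamming_form4[of m d2 i x d1' d3 j y'] u v ij by simp
  next
    case equal
    then have "d1 = d1'" "d2 = d2'" "d3 = d3'" "y = y'"
      using eq(2,4) eq5 eq6 by linarith+
    then show ?thesis
      using u v ij equal assms(4) by simp
  next
    case greater
    define m where "m = x - x'"
    have "d1' = 2 * m + d1" "d2' = d2" "d3 = d3' + 2 * m" "y' = m + y" "x = x' + m" "1 \<le> m"
      using eq(2,4) eq5 eq6 greater unfolding m_def by linarith+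
    then show ?thesis
      using hamming_form4[of m d2 i x' d1 d3' j y] hamming_sym[OF pv_length[OF assms(3)]] u v ij
      by simp
  qed
qed

section \<open>Distances in tight classes\<close>

lemma tight_hamming_pos:
  assumes "tight u" "pv u = pv v" "u \<noteq> v" "0 < moment u" "2 \<le> occ u [A]" "2 \<le> occ u [C]"
  shows "hamming_dist u v \<in> {7, 8}"
proof -
  define p q b M where "p = int (occ u [A])" "q = int (occ u [C])" "b = int (occ u [B])" "M = moment u"
  have v: "tight v" "int (occ v [A]) = p" "int (occ v [C]) = q" "int (occ v [B]) = b" "moment v = M"
    using assms(1) tight_cong[OF assms(2)] pv_occ[OF assms(2)] moment_cong[OF assms(2)]
    by (simp_all add: p_q_b_M_def)
  \<comment> \<open>\<open>form2\<close>, \<open>form4\<close> and \<open>form6\<close> have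
    positive moment, \<open>form5\<close> and \<open>form7\<close> negative moment, and
    \<open>swap\<close> reverses the sign. So a positive moment leaves five of the ten
    possibilities.\<close>
  have kinds: "(form2 w \<and> (q - 1) * b < M) \<or> (form4 w \<and> (q - 2) * b < M \<and> M < (q - 1) * b) \<or>
      (form6 w \<and> (q - 3) * b < M \<and> M < (q - 2) * b \<and> 3 \<le> p) \<or>
      (form5 (swap w) \<and> M < (q - 2) * b \<and> p = 2) \<or> (form7 (swap w) \<and> M < (q - 3) * b \<and> p = 3)"
    if w: "tight w" "int (occ w [A]) = p" "int (occ w [C]) = q" "int (occ w [B]) = b" "moment w = M" for w
  proof -
    have sw: "int (occ (swap w) [A]) = q" "int (occ (swap w) [C]) = p" "int (occ (swap w) [B]) = b"
      "moment (swap w) = - M"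
      using w by (simp_all add: occ_swap moment_swap)
    have pq: "0 \<le> b" "2 \<le> p" "2 \<le> q" "0 < M"
      using assms(4-6) by (simp_all add: p_q_b_M_def)
    have "2 \<le> occ w [A]" "2 \<le> occ w [C]"
      using w(2,3) pq by simp_all
    then consider "form2 w" | "form4 w" | "form5 w" | "form6 w" | "form7 w" |
        "form2 (swap w)" | "form4 (swap w)" | "form5 (swap w)" | "form6 (swap w)" | "form7 (swap w)"
      using tight_forms[OF w(1)] by blast
    then show ?thesis
    proof cases
      case 1
      then show ?thesis using form2_moment[OF 1] w by simp
    next
      case 2
      then show ?thesis using form4_moment[OF 2] w by simp
    next
      case 3
      then show ?thesis using form5_moment(1)[OF 3] w(5) pq(4) by simp
    next
      case 4
      then show ?thesis using form6_moment[OF 4] w by simp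
    next
      case 5
      then show ?thesis using form7_moment(1)[OF 5] w(5) pq(4) by simp
    next
      case 6
      have "0 \<le> (p - 1) * b" using pq by simp
      then show ?thesis using form2_moment(1)[OF 6] sw pq(4) by simp
    next
      case 7
      have "0 \<le> (p - 2) * b" using pq by simp
      then show ?thesis using form4_moment(1)[OF 7] sw pq(4) by simp
    next
      case 8
      then show ?thesis using form5_moment[OF 8] sw by simp
    next
      case 9
      then have "3 \<le> p" using form6_moment(3)[OF 9] sw by simp
      then have "0 \<le> (p - 3) * b" using pq by simp
      then show ?thesis using form6_moment(1)[OF 9] sw pq(4) by simp
    next
      case 10
      then show ?thesis using form7_moment[OF 10] sw by simp
    qed
  qed
  have b: "(q - 3) * b \<le> (q - 2) * b" "(q - 2) * b \<le> (q - 1) * b"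
    by (intro mult_right_mono; simp add: p_q_b_M_def)+
  \<comment> \<open>Two words of the class have the same kind: the value of \<open>p\<close> tells
    the swapped \<open>form5\<close> from \<open>form6\<close> and from the swapped
    \<open>form7\<close>, and the intervals for \<open>M\<close> separate all other pairs. Only
    \<open>form4\<close> admits two different words.\<close>
  have "(form2 u \<and> form2 v) \<or> (form4 u \<and> form4 v) \<or> (form6 u \<and> form6 v) \<or>
      (form5 (swap u) \<and> form5 (swap v)) \<or> (form7 (swap u) \<and> form7 (swap v))"
    using kinds[OF v] kinds[of u] assms(1) b unfolding p_q_b_M_def by linarith
  moreover have "swap u \<noteq> swap v"
    using assms(3) by (simp add: inj_flip inj_map_eq_map)
  ultimately show ?thesis
    using form2_unique form4_hamming form6_unique form5_unique form7_unique pv_swap assms(2,3)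
    by blast
qed

lemma tight_hamming:
  assumes "tight u" "pv u = pv v" "u \<noteq> v"
  shows "hamming_dist u v \<in> {7, 8}"
proof -
  have sw: "tight (swap u)" "pv (swap u) = pv (swap v)" "swap u \<noteq> swap v"
    using tight_swap[OF assms(1)] pv_swap[OF assms(2)] assms(3)
    by (simp_all add: inj_flip inj_map_eq_map)
  have hd: "hamming_dist (swap u) (swap v) = hamming_dist u v"
    by (rule hamming_map[OF inj_flip pv_length[OF assms(2)]])
  have "C \<in> set u"
    using tight_unique_without_C assms by blast
  moreover have "A \<in> set u"
  proof -
    \<comment> \<open>A word without a becomes a word without c under \<open>swap\<close>.\<close>
    have "C \<in> flip ` set u"
      using tight_unique_without_C[OF sw(1,2)] sw(3) by auto
    then obtain x where "x \<in> set u" "flip x = C"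
      by auto
    moreover from this have "x = A"
      using flip_flip[of x] by simp
    ultimately show ?thesis by simp
  qed
  ultimately have AC: "A \<in> set u" "C \<in> set u" "A \<in> set (swap u)"
    by (auto simp: image_iff intro!: bexI[of _ C])
  moreover have "occ u [C] \<noteq> 1"
    using tight_unique_single_C assms AC by blast
  moreover have "occ (swap u) [C] \<noteq> 1"
    using tight_unique_single_C sw AC by blast
  ultimately have two: "2 \<le> occ u [A]" "2 \<le> occ u [C]"
    using occ_eq_0_iff[of u A] occ_eq_0_iff[of u C] by (auto simp: occ_swap le_less_Suc_eq numeral_2_eq_2 Suc_le_eq intro: Suc_lessI)
  consider "0 < moment u" | "0 < moment (swap u)" | "moment u = 0"
    by (cases "moment u" "0::int" rule: linorder_cases) (auto simp: moment_swap)
  then show ?thesis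
  proof cases
    case 1
    then show ?thesis using tight_hamming_pos[OF assms] two by blast
  next
    case 2
    then show ?thesis using tight_hamming_pos[OF sw] two hd by (simp add: occ_swap)
  next
    case 3
    \<comment> \<open>Every form has a nonzero moment, so moment 0 is impossible for a tight word
      with two a and two c.\<close>
    have "moment w \<noteq> 0" if "form2 w \<or> form4 w \<or> form5 w \<or> form6 w \<or> form7 w" for w
      using that
    proof (elim disjE)
      assume f: "form2 w"
      have "0 \<le> (int (occ w [C]) - 1) * int (occ w [B])"
        using form2_moment[OF f] by (intro mult_nonneg_nonneg) simp_all
      then show ?thesis
        using form2_moment(1)[OF f] by linarith
    next
      assume f: "form4 w"
      have "0 \<le> (int (occ w [C]) - 2) * int (occ w [B])"
        using form4_moment[OF f] by (intro mult_nonneg_nonneg) simp_all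
      then show ?thesis
        using form4_moment(1)[OF f] by linarith
    next
      assume f: "form6 w"
      have "0 \<le> (int (occ w [C]) - 3) * int (occ w [B])"
        using form6_moment[OF f] by (intro mult_nonneg_nonneg) simp_all
      then show ?thesis
        using form6_moment(1)[OF f] by linarith
    qed (use form5_moment(1) form7_moment(1) in force)+
    then show ?thesis
      using tight_forms[OF assms(1)] two 3 moment_swap[of u] by force
  qed
qed

section \<open>From Parikh matrices to subword counts\<close>

lemma card_three: "a < b \<Longrightarrow> b < c \<Longrightarrow> card {a, b, c :: 'a::linorder} = 3"
  using less_trans[of a b c] by (simp add: less_imp_neq)

text \<open>Multiplying by the matrix of a letter from the left adds the next row to the row of that
  letter, which is the recursion of \<open>occ\<close>. On the diagonal the factor of abc is empty,
  and \<open>occ w []\<close> is 1.\<close>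

lemma parikh_matrix_occ:
  fixes a b c :: "'a::linorder"
  assumes "a < b" "b < c" "f A = a" "f B = b" "f C = c"
  shows "parikh_matrix {a, b, c} (map f w) =
    mat 4 4 (\<lambda>(i, j). if i \<le> j then occ w (drop i (take j [A, B, C])) else 0)"
proof (induction w)
  case Nil
  show ?case
    using card_three[OF assms(1,2)] by (intro eq_matI) (auto simp: less_Suc_eq numeral_eq_Suc)
next
  case (Cons z w)
  note card = card_three[OF assms(1,2)]
  have "{y \<in> {a, b, c}. y < a} = {}" "{y \<in> {a, b, c}. y < b} = {a}" "{y \<in> {a, b, c}. y < c} = {a, b}"
    using assms by auto
  then have index: "letter_index {a, b, c} a = 0" "letter_index {a, b, c} b = 1"
      "letter_index {a, b, c} c = 2"
    using assms by (simp_all only: letter_index_def) auto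
  show ?case
    unfolding list.map parikh_matrix.simps Cons
    by (cases z)
      (auto intro!: eq_matI simp: assms letter_matrix_def card index scalar_prod_def less_Suc_eq
        numeral_eq_Suc)
qed

lemma M_equivalent_iff_pv:
  fixes a b c :: "'a::linorder"
  assumes "a < b" "b < c" "f A = a" "f B = b" "f C = c"
  shows "M_equivalent {a, b, c} (map f u) (map f v) \<longleftrightarrow> pv u = pv v"
proof -
  have f: "f l \<in> {a, b, c}" for l
    using assms by (cases l) auto
  show ?thesis
  proof
    assume "M_equivalent {a, b, c} (map f u) (map f v)"
    then have "mat 4 4 (\<lambda>(i, j). if i \<le> j then occ u (drop i (take j [A, B, C])) else 0) $$ (i, j) =
        mat 4 4 (\<lambda>(i, j). if i \<le> j then occ v (drop i (take j [A, B, C])) else 0) $$ (i, j)" for i j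
      unfolding M_equivalent_def parikh_matrix_occ[OF assms] by simp
    from this[of 0 1] this[of 1 2] this[of 2 3] this[of 0 2] this[of 1 3] this[of 0 3]
    show "pv u = pv v"
      by (simp add: pv_def numeral_eq_Suc)
  next
    assume eq: "pv u = pv v"
    have "map f w \<in> lists {a, b, c}" for w
      unfolding in_lists_conv_set set_map using f by blast
    moreover have "mat 4 4 (\<lambda>(i, j). if i \<le> j then occ u (drop i (take j [A, B, C])) else 0) =
        mat 4 4 (\<lambda>(i, j). if i \<le> j then occ v (drop i (take j [A, B, C])) else 0)"
      using eq by (intro eq_matI) (auto simp: pv_def less_Suc_eq numeral_eq_Suc)
    ultimately show "M_equivalent {a, b, c} (map f u) (map f v)"
      unfolding M_equivalent_def parikh_matrix_occ[OF assms] by blast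
  qed
qed

theorem theorem4p8:
  fixes a b c :: "'a::linorder" and w :: "'a list"
  assumes "a < b" and "b < c"
    and "w \<in> lists {a, b, c}"
    and "M_ambiguous {a, b, c} w"
  shows "min_hamming_dist (M_class {a, b, c} w) \<in> {2, 4, 7, 8}"
proof -
  define f where "f l = (case l of A \<Rightarrow> a | B \<Rightarrow> b | C \<Rightarrow> c)" for l
  have f: "f A = a" "f B = b" "f C = c"
    by (simp_all add: f_def)
  have "inj f"
  proof (rule injI)
    fix k l assume "f k = f l"
    then show "k = l"
      using assms(1,2) f by (cases k; cases l) auto
  qed
  have image: "lists {a, b, c} = range (map f)"
  proof -
    have "range f = {a, b, c}"
    proof
      show "range f \<subseteq> {a, b, c}"
        by (auto simp: f_def split: letter.splits)
      show "{a, b, c} \<subseteq> range f"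
        using f by (metis empty_subsetI insert_subset rangeI)
    qed
    then show ?thesis
      using lists_image[of f UNIV] by simp
  qed
  obtain w0 where w0: "w = map f w0"
    using assms(3) image by auto
  have cls: "M_class {a, b, c} w = map f ` {u. pv u = pv w0}"
  proof
    show "M_class {a, b, c} w \<subseteq> map f ` {u. pv u = pv w0}"
    proof
      fix v assume v: "v \<in> M_class {a, b, c} w"
      then have "v \<in> lists {a, b, c}"
        by (simp add: M_class_def M_equivalent_def)
      then obtain v0 where "v = map f v0"
        using image by auto
      then show "v \<in> map f ` {u. pv u = pv w0}"
        using v w0 M_equivalent_iff_pv[OF assms(1,2) f, of w0 v0] by (auto simp: M_class_def)
    qed
    show "map f ` {u. pv u = pv w0} \<subseteq> M_class {a, b, c} w"
    proof
      fix v assume "v \<in> map f ` {u. pv u = pv w0}"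
      then obtain u where "v = map f u" "pv w0 = pv u"
        by auto
      then show "v \<in> M_class {a, b, c} w"
        using w0 M_equivalent_iff_pv[OF assms(1,2) f, of w0 u] by (simp add: M_class_def)
    qed
  qed
  define D where "D d \<longleftrightarrow> (\<exists>u v. pv u = pv w0 \<and> pv v = pv w0 \<and> u \<noteq> v \<and> d = hamming_dist u v)" for d
  have "(\<exists>u v. u \<in> M_class {a, b, c} w \<and> v \<in> M_class {a, b, c} w \<and> u \<noteq> v \<and> d = hamming_dist u v) \<longleftrightarrow> D d" for d
  proof -
    have ham: "hamming_dist (map f u) (map f v) = hamming_dist u v"
      if "pv u = pv w0" "pv v = pv w0" for u v
      using hamming_map[OF \<open>inj f\<close>] pv_length[of u v] that by simp
    have inj: "map f u = map f v \<longleftrightarrow> u = v" for u v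
      by (rule inj_map_eq_map[OF \<open>inj f\<close>])
    show ?thesis
    proof
      assume "\<exists>u v. u \<in> M_class {a, b, c} w \<and> v \<in> M_class {a, b, c} w \<and> u \<noteq> v \<and> d = hamming_dist u v"
      then obtain u v where "pv u = pv w0" "pv v = pv w0" "map f u \<noteq> map f v"
          "d = hamming_dist (map f u) (map f v)"
        unfolding cls by auto
      then show "D d"
        unfolding D_def inj using ham by metis
    next
      assume "D d"
      then obtain u v where "pv u = pv w0" "pv v = pv w0" "u \<noteq> v" "d = hamming_dist u v"
        unfolding D_def by auto
      then have "map f u \<in> M_class {a, b, c} w" "map f v \<in> M_class {a, b, c} w"
          "map f u \<noteq> map f v" "d = hamming_dist (map f u) (map f v)"
        using ham inj unfolding cls by auto
      then show "\<exists>u v. u \<in> M_class {a, b, c} w \<and> v \<in> M_class {a, b, c} w \<and> u \<noteq> v \<and> d = hamming_dist u v"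
        by blast
    qed
  qed
  then have min: "min_hamming_dist (M_class {a, b, c} w) = (LEAST d. D d)"
    unfolding min_hamming_dist_def by simp
  \<comment> \<open>Ambiguity makes \<open>D\<close> hold for some distance, so \<open>LEAST\<close>
    is attained.\<close>
  obtain v where "v \<in> M_class {a, b, c} w" "v \<noteq> w"
    using assms(4) by (auto simp: M_ambiguous_def M_class_def)
  then have "v \<in> map f ` {u. pv u = pv w0}"
    unfolding cls by simp
  then obtain v0 where "v = map f v0" "pv v0 = pv w0"
    by auto
  moreover from this have "v0 \<noteq> w0"
    using w0 \<open>v \<noteq> w\<close> by auto
  ultimately have "D (hamming_dist v0 w0)"
    unfolding D_def by blast
  then have least: "D (LEAST d. D d)"
    by (rule LeastI)
  show ?thesis
  proof (cases "tight w0")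
    case True
    then have "d \<in> {7, 8}" if "D d" for d
      using that tight_cong tight_hamming unfolding D_def by metis
    then show ?thesis
      using least min by auto
  next
    case False
    \<comment> \<open>Some distance is at most 4; since 0, 1 and 3 never occur, the least one is 2
      or 4.\<close>
    then obtain d where "D d" "d \<le> 4"
      unfolding tight_def D_def by (metis not_less)
    then have "(LEAST d. D d) \<le> 4"
      using Least_le[of D d] by simp
    moreover have "(LEAST d. D d) \<notin> {0, 1, 3}"
      using least hamming_ne_0_1_3 unfolding D_def by metis
    ultimately show ?thesis
      unfolding min by (auto simp: le_Suc_eq numeral_eq_Suc)
  qed
qed

end
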